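(* Let $R$ be a finite noncommutative ring such that $|R|\notin\{8,12,16,24,28\}$, and let $r\in R$. Then $\Delta_R^r$ is $6$-regular if and only if $r=0$ and $R$ is isomorphic to $E(9)$ or $F(9)$. In particular, the noncommuting graph of such a ring $R$ is $6$-regular if and only if $R$ is isomorphic to $E(9)$ or $F(9)$.
   Context: Rings are associative and not assumed to have a unity. $[x,y]:=xy-yx$. $Z(R)$ is the center of $R$. $\Delta_R^r$ is the simple undirected graph with vertex set $R\setminus Z(R)$ in which two distinct vertices $x,y$ are adjacent if and only if $[x,y]\neq r$ and $[x,y]\neq -r$. The noncommuting graph of $R$ is the simple undirected graph with vertex set $R\setminus Z(R)$ in which $x,y$ are adjacent if and only if $xy\neq yx$ (so it equals $\Delta_R^0$). For a prime $p$, $E(p^2)=\langle a,b: pa=pb=0,\ a^2=a,\ b^2=b,\ ab=a,\ ba=b\rangle$ and $F(p^2)=\langle x,y: px=py=0,\ x^2=x,\ y^2=y,\ xy=y,\ yx=x\rangle$; these are (non-unital) rings of order $p^2$ whose additive group is free over $\mathbb{Z}/p$ on the two generators, with multiplication determined bilinearly by the given relations. *)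

theory Defs
  imports "HOL-Library.Numeral_Type"
begin

text \<open>The type class \<open>ring\<close> is that of associative rings without a unity requirement,
  so a ring \<open>R\<close> is a type of this class and an isomorphism class of rings is addressed through
  the type.\<close>

definition ring_isomorphic :: "'a::ring itself \<Rightarrow> 'b::ring itself \<Rightarrow> bool" where
  "ring_isomorphic _ _ \<longleftrightarrow>
     (\<exists>f :: 'a \<Rightarrow> 'b. bij f \<and> (\<forall>x y. f (x + y) = f x + f y) \<and> (\<forall>x y. f (x * y) = f x * f y))"

definition commutator :: "'a::ring \<Rightarrow> 'a \<Rightarrow> 'a" where
  "commutator x y = x * y - y * x"

definition ring_center :: "'a::ring set" where
  "ring_center = {z. \<forall>x. z * x = x * z}"


text \<open>A simple undirected graph is a vertex set together with a set of two-element subsets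
  of it.\<close>

type_synonym 'a graph = "'a set \<times> 'a set set"

definition graph_degree :: "'a graph \<Rightarrow> 'a \<Rightarrow> nat" where
  "graph_degree G v = card {e \<in> snd G. v \<in> e}"

definition k_regular :: "nat \<Rightarrow> 'a graph \<Rightarrow> bool" where
  "k_regular k G \<longleftrightarrow> (\<forall>v \<in> fst G. graph_degree G v = k)"

definition Delta_graph :: "'a::ring \<Rightarrow> 'a graph" where
  "Delta_graph r =
     (UNIV - ring_center,
      {{x, y} | x y. x \<in> UNIV - ring_center \<and> y \<in> UNIV - ring_center \<and> x \<noteq> y \<and>
                     commutator x y \<noteq> r \<and> commutator x y \<noteq> - r})"

definition noncommuting_graph :: "'a::ring graph" where
  "noncommuting_graph =
     (UNIV - ring_center,
      {{x, y} | x y. x \<in> UNIV - ring_center \<and> y \<in> UNIV - ring_center \<and> x * y \<noteq> y * x})"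

lemma noncommuting_graph_eq_Delta_graph: "noncommuting_graph = Delta_graph 0"
  unfolding noncommuting_graph_def Delta_graph_def commutator_def by fastforce


text \<open>The element \<open>E_elem s t\<close> stands for \<open>s a + t b\<close> and the product is the bilinear extension of
  \<open>a\<^sup>2 = a\<close>, \<open>b\<^sup>2 = b\<close>, \<open>ab = a\<close>, \<open>ba = b\<close>. The coefficients range over \<open>'p\<close>, for which the
  numeral type \<open>p\<close> of integers modulo \<open>p\<close> is to be substituted: \<open>E(p\<^sup>2)\<close> is
  \<open>p E_ring\<close>, and likewise below for \<open>F(p\<^sup>2)\<close>.\<close>

datatype 'p E_ring = E_elem (E_coeff_a: 'p) (E_coeff_b: 'p)

instantiation E_ring :: (comm_ring_1) ring
begin

definition "0 = E_elem 0 0"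
definition "u + v = E_elem (E_coeff_a u + E_coeff_a v) (E_coeff_b u + E_coeff_b v)"
definition "- u = E_elem (- E_coeff_a u) (- E_coeff_b u)"
definition "u - v = E_elem (E_coeff_a u - E_coeff_a v) (E_coeff_b u - E_coeff_b v)"
definition "u * v =
  E_elem (E_coeff_a u * E_coeff_a v + E_coeff_a u * E_coeff_b v)
         (E_coeff_b u * E_coeff_b v + E_coeff_b u * E_coeff_a v)"

instance
  by standard
    (simp_all add: zero_E_ring_def plus_E_ring_def uminus_E_ring_def minus_E_ring_def
      times_E_ring_def algebra_simps)

end

text \<open>The element \<open>F_elem s t\<close> stands for \<open>s x + t y\<close> and the product is the bilinear extension of
  \<open>x\<^sup>2 = x\<close>, \<open>y\<^sup>2 = y\<close>, \<open>xy = y\<close>, \<open>yx = x\<close>.\<close>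

datatype 'p F_ring = F_elem (F_coeff_x: 'p) (F_coeff_y: 'p)

instantiation F_ring :: (comm_ring_1) ring
begin

definition "0 = F_elem 0 0"
definition "u + v = F_elem (F_coeff_x u + F_coeff_x v) (F_coeff_y u + F_coeff_y v)"
definition "- u = F_elem (- F_coeff_x u) (- F_coeff_y u)"
definition "u - v = F_elem (F_coeff_x u - F_coeff_x v) (F_coeff_y u - F_coeff_y v)"
definition "u * v =
  F_elem (F_coeff_x u * F_coeff_x v + F_coeff_y u * F_coeff_x v)
         (F_coeff_y u * F_coeff_y v + F_coeff_x u * F_coeff_y v)"

instance
  by standard
    (simp_all add: zero_F_ring_def plus_F_ring_def uminus_F_ring_def minus_F_ring_def
      times_F_ring_def algebra_simps)

end

lemma E_ring_relations:
  defines "a \<equiv> E_elem 1 0 :: 'p::comm_ring_1 E_ring" and "b \<equiv> E_elem 0 1"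
  shows "a * a = a" "b * b = b" "a * b = a" "b * a = b"
  by (simp_all add: a_def b_def times_E_ring_def)

lemma F_ring_relations:
  defines "x \<equiv> F_elem 1 0 :: 'p::comm_ring_1 F_ring" and "y \<equiv> F_elem 0 1"
  shows "x * x = x" "y * y = y" "x * y = y" "y * x = x"
  by (simp_all add: x_def y_def times_F_ring_def)

lemma E9_characteristic: "u + u + u = (0 :: 3 E_ring)"
proof -
  have "s + s + s = 0" for s :: 3
  proof -
    have "s + s + s = 3 * s" by (metis distrib_right mult_1 numeral_Bit1 numeral_One one_add_one numeral_Bit0)
    also have "(3 :: 3) = 0" by simp
    finally show ?thesis by simp
  qed
  then show ?thesis by (simp add: plus_E_ring_def zero_E_ring_def)
qed

lemma F9_characteristic: "u + u + u = (0 :: 3 F_ring)"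
proof -
  have "s + s + s = 0" for s :: 3
    using E9_characteristic[of "E_elem s 0"] by (simp add: plus_E_ring_def zero_E_ring_def)
  then show ?thesis by (simp add: plus_F_ring_def zero_F_ring_def)
qed

lemma card_E9: "CARD(3 E_ring) = 9"
proof -
  have "bij (\<lambda>(s, t). E_elem s t :: 3 E_ring)"
    by (rule bijI') (auto, metis E_ring.collapse)
  then have "CARD(3 \<times> 3) = CARD(3 E_ring)" by (rule bij_betw_same_card)
  then show ?thesis by simp
qed

lemma card_F9: "CARD(3 F_ring) = 9"
proof -
  have "bij (\<lambda>(s, t). F_elem s t :: 3 F_ring)"
    by (rule bijI') (auto, metis F_ring.collapse)
  then have "CARD(3 \<times> 3) = CARD(3 F_ring)" by (rule bij_betw_same_card)
  then show ?thesis by simp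
qed

end

theory Submission
  imports Defs
begin

text \<open>The vertices adjacent to \<open>x\<close> are counted through the cosets of the centralizer
  \<open>C(x)\<close>: if \<open>r = 0\<close>, the degree is \<open>|R| - |C(x)|\<close>; if \<open>r \<noteq> 0\<close>, it is
  \<open>|R| - |Z(R)| - 1 - k |C(x)|\<close>, where \<open>k\<close> is the number (0, 1 or 2) of distinct values among
  \<open>r, -r\<close> of the form \<open>[x, y]\<close>. As \<open>|Z(R)|\<close> divides \<open>|C(x)|\<close> and \<open>|C(x)|\<close> divides
  \<open>|R|\<close>, both properly, degree 6 leaves few orders. Those that are not excluded and differ from 9
  are impossible because \<open>|C(x)|\<close> and its index cannot be coprime: both annihilate
  \<open>[x, y]\<close>. In a noncommutative ring of order 9 every \<open>x \<noteq> 0\<close> has centralizer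
  \<open>{0, x, -x}\<close>, so all squares satisfy \<open>x\<^sup>2 \<in> {0, x, -x}\<close>; this yields two independent
  idempotents \<open>x, y\<close> with \<open>xy + yx = x + y\<close>, and then \<open>xy\<close> is \<open>x\<close> or \<open>y\<close>.\<close>


section \<open>Finite additive subgroups\<close>

definition add_subgroup :: "'a::ab_group_add set \<Rightarrow> bool" where
  "add_subgroup H \<longleftrightarrow> 0 \<in> H \<and> (\<forall>x\<in>H. \<forall>y\<in>H. x - y \<in> H)"

lemma add_subgroup_zero: "add_subgroup H \<Longrightarrow> 0 \<in> H"
  by (simp add: add_subgroup_def)

lemma add_subgroup_diff: "add_subgroup H \<Longrightarrow> x \<in> H \<Longrightarrow> y \<in> H \<Longrightarrow> x - y \<in> H"
  by (simp add: add_subgroup_def)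

lemma add_subgroup_minus: "add_subgroup H \<Longrightarrow> x \<in> H \<Longrightarrow> - x \<in> H"
  using add_subgroup_diff[of H 0 x] add_subgroup_zero[of H] by simp

lemma add_subgroup_add: "add_subgroup H \<Longrightarrow> x \<in> H \<Longrightarrow> y \<in> H \<Longrightarrow> x + y \<in> H"
  using add_subgroup_diff[of H x "- y"] add_subgroup_minus[of H y] by simp

text \<open>A ring without unity has no \<open>of_nat\<close>, so natural multiples are taken in the
  additive monoid.\<close>

fun nat_mult :: "nat \<Rightarrow> 'a::monoid_add \<Rightarrow> 'a" where
  "nat_mult 0 x = 0"
| "nat_mult (Suc n) x = x + nat_mult n x"

lemma nat_mult_add: "nat_mult (m + n) x = nat_mult m x + nat_mult n x"
  by (induction m) (simp_all add: add.assoc)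

lemma nat_mult_zero_right: "nat_mult n 0 = 0"
  by (induction n) simp_all

lemma nat_mult_mult: "nat_mult (m * n) x = nat_mult m (nat_mult n x)"
  by (induction m) (simp_all add: nat_mult_add)

lemma nat_mult_coprime_eq_0:
  fixes x :: "'a::ab_group_add"
  assumes "nat_mult m x = 0" "nat_mult n x = 0" "coprime m n"
  shows "x = 0"
proof (cases "m = 0")
  case True
  \<comment> \<open>Here \<open>coprime 0 n\<close> forces \<open>n = 1\<close>;
    \<open>bezout_nat\<close> covers only nonzero \<open>m\<close>.\<close>
  then show ?thesis using assms by simp
next
  case False
  obtain a b where "a * m = b * n + gcd m n"
    using bezout_nat[OF False] by (metis mult.commute)
  then have "nat_mult (a * m) x = nat_mult (b * n + 1) x"
    using assms(3) by simp
  then show ?thesis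
    using assms(1,2) by (simp add: nat_mult_mult nat_mult_add nat_mult_zero_right)
qed

lemma sum_const_nat_mult: "finite H \<Longrightarrow> (\<Sum>_\<in>H. x) = nat_mult (card H) (x :: 'a::ab_group_add)"
  by (induction H rule: finite_induct) simp_all

text \<open>Translation by \<open>x\<close> permutes \<open>H\<close>, so it preserves the sum of the elements of \<open>H\<close>.\<close>

lemma nat_mult_card_eq_0:
  assumes H: "add_subgroup H" and fin: "finite H" and x: "x \<in> H"
  shows "nat_mult (card H) x = 0"
proof -
  have "bij_betw (\<lambda>h. h + x) H H"
    by (rule bij_betw_byWitness[where f' = "\<lambda>h. h - x"])
      (use H x in \<open>auto intro: add_subgroup_add add_subgroup_diff\<close>)
  then have "(\<Sum>h\<in>H. h + x) = (\<Sum>h\<in>H. h)"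
    by (rule sum.reindex_bij_betw)
  then show ?thesis
    using fin by (simp add: sum.distrib sum_const_nat_mult)
qed

text \<open>Lagrange's theorem: the cosets of \<open>H\<close> partition \<open>K\<close> into
  blocks of size \<open>card H\<close>.\<close>

lemma card_subgroup_dvd:
  assumes H: "add_subgroup H" and K: "add_subgroup K" and sub: "H \<subseteq> K" and fin: "finite K"
  shows "card H dvd card K"
proof -
  let ?C = "(\<lambda>x. (+) x ` H) ` K"
  have un: "\<Union>?C = K"
  proof
    show "\<Union>?C \<subseteq> K" using sub K by (auto intro: add_subgroup_add)
    show "K \<subseteq> \<Union>?C"
      using add_subgroup_zero[OF H] by force
  qed
  have disj: "A \<inter> B = {}" if A: "A \<in> ?C" and B: "B \<in> ?C" and "A \<noteq> B" for A B
  proof (rule ccontr)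
    assume "A \<inter> B \<noteq> {}"
    from A B obtain x y where xy: "A = (+) x ` H" "B = (+) y ` H" by auto
    then obtain h k where hk: "h \<in> H" "k \<in> H" "x + h = y + k"
      using \<open>A \<inter> B \<noteq> {}\<close> by auto
    have sub1: "(+) x ` H \<subseteq> (+) y ` H" if "h \<in> H" "k \<in> H" "x + h = y + k" for x y h k
    proof
      fix w assume "w \<in> (+) x ` H"
      then obtain l where l: "l \<in> H" "w = x + l" by auto
      have "w = y + (l - h + k)" using l that by (simp add: algebra_simps)
      then show "w \<in> (+) y ` H"
        using l that H by (blast intro: add_subgroup_add add_subgroup_diff)
    qed
    have "A = B"
      using sub1[OF hk] sub1[OF hk(2,1) hk(3)[symmetric]] xy by auto
    then show False using \<open>A \<noteq> B\<close> by simp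
  qed
  have "card H dvd card (\<Union>?C)"
  proof (rule dvd_partition)
    show "finite (\<Union>?C)" using fin by (simp only: un)
    show "\<forall>A\<in>?C. card H dvd card A" by (simp add: card_image)
    show "\<forall>A\<in>?C. \<forall>B\<in>?C. A \<noteq> B \<longrightarrow> A \<inter> B = {}" using disj by blast
  qed
  then show ?thesis by (simp only: un)
qed


section \<open>Centralizers\<close>

definition centralizer :: "'a::ring \<Rightarrow> 'a set" where
  "centralizer x = {y. x * y = y * x}"

lemma add_subgroup_UNIV: "add_subgroup UNIV"
  by (simp add: add_subgroup_def)

lemma add_subgroup_center: "add_subgroup (ring_center :: 'a::ring set)"
  by (auto simp: add_subgroup_def ring_center_def algebra_simps)

lemma add_subgroup_centralizer: "add_subgroup (centralizer x)"
  by (auto simp: add_subgroup_def centralizer_def algebra_simps)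

lemma centralizer_self: "x \<in> centralizer x"
  by (simp add: centralizer_def)

lemma center_subset_centralizer: "ring_center \<subseteq> centralizer x"
  by (auto simp: ring_center_def centralizer_def)

lemma commutator_add_right: "commutator x (y + z) = commutator x y + commutator x z"
  by (simp add: commutator_def algebra_simps)

lemma commutator_diff_right: "commutator x (y - z) = commutator x y - commutator x z"
  by (simp add: commutator_def algebra_simps)

lemma commutator_minus_right: "commutator x (- y) = - commutator x y"
  by (simp add: commutator_def algebra_simps)

lemma commutator_swap: "commutator y x = - commutator x y"
  by (simp add: commutator_def)

lemma commutator_self: "commutator x x = 0"
  by (simp add: commutator_def)

lemma centralizer_commutator: "centralizer x = {y. commutator x y = 0}"
  by (simp add: centralizer_def commutator_def)

lemma center_commutator: "z \<in> ring_center \<Longrightarrow> commutator x z = 0"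
  by (simp add: ring_center_def commutator_def)

text \<open>The map \<open>commutator x\<close> is additive with kernel
  \<open>centralizer x\<close>, so its nonempty fibres are cosets of the centralizer.\<close>

lemma card_commutator_fibre:
  "card {y. commutator x y = commutator x y0} = card (centralizer x)"
proof -
  have "{y. commutator x y = commutator x y0} = (+) y0 ` centralizer x"
  proof (intro equalityI subsetI)
    fix y assume "y \<in> {y. commutator x y = commutator x y0}"
    then have "y - y0 \<in> centralizer x"
      by (simp add: centralizer_commutator commutator_diff_right)
    then show "y \<in> (+) y0 ` centralizer x"
      by (intro image_eqI[of _ _ "y - y0"]) simp_all
  next
    fix y assume "y \<in> (+) y0 ` centralizer x"
    then show "y \<in> {y. commutator x y = commutator x y0}"
      by (auto simp: centralizer_commutator commutator_add_right)
  qed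
  then show ?thesis by (simp add: card_image)
qed

text \<open>Summing over the fibres of \<open>commutator x\<close> identifies the index of the
  centralizer with the order of the image.\<close>

lemma card_eq_commutators_times_centralizer:
  fixes x :: "'a::{ring, finite}"
  shows "CARD('a) = card (range (commutator x)) * card (centralizer x)"
proof -
  have "CARD('a) = (\<Sum>c\<in>range (commutator x). card {y. commutator x y = c})"
    using sum.group[of "UNIV :: 'a set" "range (commutator x)" "commutator x" "\<lambda>_. 1 :: nat"]
    by simp
  also have "\<dots> = (\<Sum>c\<in>range (commutator x). card (centralizer x))"
    by (rule sum.cong) (auto simp: card_commutator_fibre)
  finally show ?thesis by simp
qed

lemma nat_mult_commutator: "nat_mult n (commutator x y) = commutator (nat_mult n x) y"
  by (induction n) (simp_all add: commutator_def algebra_simps)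

lemma centralizer_index_not_coprime:
  fixes x :: "'a::{ring, finite}"
  assumes x: "x \<notin> ring_center" and n: "CARD('a) = m * card (centralizer x)"
  shows "\<not> coprime m (card (centralizer x))"
proof
  assume cop: "coprime m (card (centralizer x))"
  have "card (centralizer x) > 0"
    using centralizer_self[of x] by (auto simp: card_gt_0_iff)
  moreover have "m * card (centralizer x) = card (range (commutator x)) * card (centralizer x)"
    using n card_eq_commutators_times_centralizer[of x] by metis
  ultimately have m: "m = card (range (commutator x))"
    by (metis mult_cancel2 less_not_refl)
  \<comment> \<open>The index \<open>m\<close> is thus the order of a group containing every
    \<open>commutator x y\<close>, hence annihilates them all.\<close>
  have "add_subgroup (range (commutator x))"
    unfolding add_subgroup_def
    by (auto simp flip: commutator_diff_right) (metis commutator_self rangeI)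
  then have "nat_mult m (commutator x y) = 0" for y
    unfolding m by (rule nat_mult_card_eq_0) auto
  \<comment> \<open>Since \<open>x\<close> lies in its own centralizer,
    \<open>card (centralizer x)\<close> annihilates \<open>x\<close>, and biadditivity carries this
    over to \<open>commutator x y\<close>.\<close>
  moreover have "nat_mult (card (centralizer x)) (commutator x y) = 0" for y
    using nat_mult_card_eq_0[OF add_subgroup_centralizer _ centralizer_self, of x]
    by (simp add: nat_mult_commutator) (simp add: commutator_def)
  ultimately have "commutator x y = 0" for y
    using cop nat_mult_coprime_eq_0 by blast
  then show False
    using x by (simp add: ring_center_def commutator_def)
qed

lemma noncentral_card_facts:
  fixes x :: "'a::{ring, finite}"
  assumes x: "x \<notin> ring_center"
  shows "card (ring_center :: 'a set) dvd card (centralizer x)"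
    "card (centralizer x) dvd CARD('a)"
    "0 < card (ring_center :: 'a set)"
    "card (ring_center :: 'a set) < card (centralizer x)"
    "card (centralizer x) < CARD('a)"
proof -
  show "card (ring_center :: 'a set) dvd card (centralizer x)"
    by (intro card_subgroup_dvd add_subgroup_center add_subgroup_centralizer
        center_subset_centralizer) simp
  show "card (centralizer x) dvd CARD('a)"
    by (intro card_subgroup_dvd add_subgroup_UNIV add_subgroup_centralizer) simp_all
  show "0 < card (ring_center :: 'a set)"
    using add_subgroup_zero[OF add_subgroup_center] by (auto simp: card_gt_0_iff)
  show "card (ring_center :: 'a set) < card (centralizer x)"
    by (intro psubset_card_mono) (use x center_subset_centralizer centralizer_self in auto)
  have "centralizer x \<noteq> UNIV"
    using x by (force simp: ring_center_def centralizer_def)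
  then show "card (centralizer x) < CARD('a)"
    by (intro psubset_card_mono) auto
qed


section \<open>Degrees\<close>

lemma graph_degree_Delta:
  assumes x: "x \<notin> ring_center"
  shows "graph_degree (Delta_graph r) x =
    card {y. y \<notin> ring_center \<and> y \<noteq> x \<and> commutator x y \<noteq> r \<and> commutator x y \<noteq> - r}"
    (is "_ = card ?N")
proof -
  \<comment> \<open>Adjacency is symmetric: swapping the arguments negates the commutator, and the
    forbidden set \<open>{r, - r}\<close> is closed under negation.\<close>
  have swap: "commutator y x \<noteq> r \<and> commutator y x \<noteq> - r \<longleftrightarrow>
      commutator x y \<noteq> r \<and> commutator x y \<noteq> - r" for y
    unfolding commutator_swap[of y x] by (metis minus_minus)
  have "{e \<in> snd (Delta_graph r). x \<in> e} = (\<lambda>y. {x, y}) ` ?N" (is "?L = ?R")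
  proof (intro equalityI subsetI)
    fix e assume "e \<in> ?L"
    then obtain u v where "e = {u, v}" "x = u \<or> x = v" "u \<notin> ring_center" "v \<notin> ring_center"
      "u \<noteq> v" "commutator u v \<noteq> r \<and> commutator u v \<noteq> - r"
      by (auto simp: Delta_graph_def)
    then show "e \<in> ?R"
      using swap by (auto simp: insert_commute)
  next
    fix e assume "e \<in> ?R"
    then show "e \<in> ?L" using x by (auto simp: Delta_graph_def)
  qed
  moreover have "inj_on (\<lambda>y. {x, y}) ?N"
    by (auto simp: inj_on_def doubleton_eq_iff)
  ultimately show ?thesis
    by (simp add: graph_degree_def card_image)
qed

text \<open>For \<open>r = 0\<close> the vertex itself and the central elements already commute with
  \<open>x\<close>, so the complement of the neighbourhood is just the centralizer.\<close>

lemma degree_zero: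
  fixes x :: "'a::{ring, finite}"
  assumes x: "x \<notin> ring_center"
  shows "graph_degree (Delta_graph 0) x + card (centralizer x) = CARD('a)"
proof -
  have "{y. y \<notin> ring_center \<and> y \<noteq> x \<and> commutator x y \<noteq> 0 \<and> commutator x y \<noteq> - 0} =
      UNIV - centralizer x"
    using center_commutator commutator_self by (auto simp: centralizer_commutator)
  then show ?thesis
    using noncentral_card_facts(5)[OF x]
    by (simp add: graph_degree_Delta[OF x] card_Diff_subset)
qed

lemma degree_nonzero:
  fixes x r :: "'a::{ring, finite}"
  assumes x: "x \<notin> ring_center" and r: "r \<noteq> 0"
  obtains k where "k \<in> {0, 1, 2}"
    "graph_degree (Delta_graph r) x + card (ring_center :: 'a set) + 1 + k * card (centralizer x)
      = CARD('a)"
proof -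
  let ?N = "{y. y \<notin> ring_center \<and> y \<noteq> x \<and> commutator x y \<noteq> r \<and> commutator x y \<noteq> - r}"
  let ?S = "{y. commutator x y = r \<or> commutator x y = - r}"
  have S_noncentral: "ring_center \<inter> ?S = {}"
    using r center_commutator by fastforce
  have S_self: "x \<notin> ?S" using r by (auto simp: commutator_self)
  have "(UNIV :: 'a set) = ?N \<union> (insert x ring_center \<union> ?S)"
    by auto
  then have "CARD('a) = card (?N \<union> (insert x ring_center \<union> ?S))" by simp
  also have "\<dots> = card ?N + card (insert x ring_center \<union> ?S)"
    by (rule card_Un_disjoint) auto
  also have "card (insert x ring_center \<union> ?S) = card (insert x ring_center) + card ?S"
    by (rule card_Un_disjoint) (use S_noncentral S_self in auto)
  finally have count: "CARD('a) = card ?N + card (ring_center :: 'a set) + 1 + card ?S"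
    using x by simp
  \<comment> \<open>If \<open>r\<close> is not a value of \<open>commutator x\<close>, neither is
    \<open>- r\<close>, and \<open>k = 0\<close>. Otherwise both fibres have the size of the
    centralizer; they coincide when \<open>r = - r\<close> (\<open>k = 1\<close>) and are disjoint
    when not (\<open>k = 2\<close>).\<close>
  have "\<exists>k. k \<in> {0, 1, 2} \<and> card ?S = k * card (centralizer x)"
  proof (cases "\<exists>y. commutator x y = r")
    case False
    then have "commutator x y \<noteq> - r" for y
      using commutator_minus_right[of x y] by (metis minus_minus)
    with False have "?S = {}" by auto
    then show ?thesis by (intro exI[of _ 0]) simp
  next
    case True
    then obtain y where y: "commutator x y = r" by auto
    have plus: "card {y. commutator x y = r} = card (centralizer x)"
      using card_commutator_fibre[of x y] y by simp
    have minus: "card {y. commutator x y = - r} = card (centralizer x)"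
      using card_commutator_fibre[of x "- y"] y by (simp add: commutator_minus_right)
    show ?thesis
    proof (cases "r = - r")
      case True
      then have "?S = {y. commutator x y = r}" by auto
      then show ?thesis using plus by (intro exI[of _ 1]) simp
    next
      case False
      have "?S = {y. commutator x y = r} \<union> {y. commutator x y = - r}" by auto
      moreover have "card ({y. commutator x y = r} \<union> {y. commutator x y = - r}) =
          card {y. commutator x y = r} + card {y. commutator x y = - r}"
        by (rule card_Un_disjoint) (use False in auto)
      ultimately show ?thesis using plus minus by (intro exI[of _ 2]) simp
    qed
  qed
  then obtain k where k: "k \<in> {0, 1, 2}" "card ?S = k * card (centralizer x)" by blast
  show ?thesis
    by (rule that[OF k(1)]) (use count k(2) in \<open>simp add: graph_degree_Delta[OF x]\<close>)
qed

section \<open>Orders compatible with degree 6\<close>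

text \<open>In \<open>n = 7 + z + k * c\<close> the divisibilities of \<open>z\<close> by
  \<open>c\<close> and \<open>c\<close> by \<open>n\<close> (each the divisor of the next) give
  \<open>z dvd 7\<close> and \<open>c dvd 7 + z\<close>. The few resulting values of
  \<open>n\<close> are in the list, except 10, 14 and 42.\<close>

lemma degree_six_nonzero:
  fixes x r :: "'a::{ring, finite}"
  assumes x: "x \<notin> ring_center" and r: "r \<noteq> 0"
    and deg: "graph_degree (Delta_graph r) x = 6"
  shows "CARD('a) \<in> {8, 12, 16, 24, 28}"
proof -
  define z c n where "z = card (ring_center :: 'a set)" and "c = card (centralizer x)"
    and "n = CARD('a)"
  obtain k where k: "k \<in> {0, 1, 2}" "7 + z + k * c = n"
    using degree_nonzero[OF x r] deg by (auto simp: z_def c_def n_def)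
  have facts: "z dvd c" "c dvd n" "0 < z" "z < c" "c < n"
    using noncentral_card_facts[OF x] by (simp_all add: z_def c_def n_def)
  have cop: "\<not> coprime m c" if "n = m * c" for m
    using centralizer_index_not_coprime[OF x, of m] that by (simp add: c_def n_def)
  have "z dvd 7 + (z + k * c)"
    using facts(1,2) k(2) by (metis dvd_trans add.assoc)
  then have "z dvd 7"
    using facts(1) by (metis dvd_add dvd_refl dvd_mult dvd_add_left_iff)
  then have "z \<le> 7" by (rule dvd_imp_le) simp
  then have "z \<in> {1, 2, 3, 4, 5, 6, 7}" using facts(3) by auto
  with \<open>z dvd 7\<close> have z: "z = 1 \<or> z = 7" by auto
  have "c dvd 7 + z + k * c" using facts(2) k(2) by simp
  then have "c dvd 7 + z" by (simp add: dvd_add_left_iff)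
  show ?thesis
  proof (cases "z = 1")
    case True
    with \<open>c dvd 7 + z\<close> have "c dvd 8" by simp
    then have "c \<le> 8" by (rule dvd_imp_le) simp
    moreover have "c \<in> {2, 3, 4, 5, 6, 7, 8}" using \<open>c \<le> 8\<close> facts(4) True by auto
    ultimately have c: "c = 2 \<or> c = 4 \<or> c = 8"
      using \<open>c dvd 8\<close> by auto
    \<comment> \<open>With \<open>n = 8 + k * c\<close>, this is the only value outside the list. It
      would make the centralizer have order 2 and the coprime index 5.\<close>
    have "n \<noteq> 10"
    proof
      assume "n = 10"
      then have "c = 2" using facts(2) c by auto
      then show False using cop[of 5] \<open>n = 10\<close> by simp
    qed
    then show ?thesis
      using k True c by (auto simp: n_def)
  next
    case False
    with z have "z = 7" by simp
    with \<open>c dvd 7 + z\<close> have "c dvd 14" by simp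
    then have "c \<le> 14" by (rule dvd_imp_le) simp
    obtain d where "c = 7 * d" using facts(1) \<open>z = 7\<close> by blast
    \<comment> \<open>A multiple of 7 that exceeds 7 and is at most 14.\<close>
    then have c: "c = 14" using facts(4) \<open>z = 7\<close> \<open>c \<le> 14\<close> by auto
    have "n \<noteq> 42"
    proof
      assume "n = 42"
      moreover have "coprime (3::nat) 14" by (simp add: coprime_iff_gcd_eq_1 gcd_nat.simps)
      ultimately show False using cop[of 3] c by simp
    qed
    \<comment> \<open>Now \<open>n = 14 + 14 * k\<close>: 14 is excluded by \<open>c < n\<close>, 42
      by the coprimality of 3 and 14, and 28 is listed.\<close>
    then show ?thesis
      using k c \<open>z = 7\<close> facts(5) by (auto simp: n_def)
  qed
qed

lemma degree_six_zero:
  fixes x :: "'a::{ring, finite}"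
  assumes x: "x \<notin> ring_center" and deg: "graph_degree (Delta_graph 0) x = 6"
  shows "CARD('a) \<in> {8, 9, 12}"
proof -
  define c where "c = card (centralizer x)"
  have n: "6 + c = CARD('a)" using degree_zero[OF x] deg by (simp add: c_def)
  have facts: "c dvd CARD('a)" "1 < c"
    using noncentral_card_facts[OF x] by (simp_all add: c_def)
  have "c dvd 6" using facts(1) n by (metis dvd_add_left_iff dvd_refl)
  then have "c \<le> 6" by (rule dvd_imp_le) simp
  then have "c \<in> {2, 3, 4, 5, 6}" using facts(2) by auto
  with \<open>c dvd 6\<close> have "c \<in> {2, 3, 6}" by auto
  then show ?thesis using n by auto
qed


section \<open>Noncommutative rings of order 9\<close>

lemma order_9_cards:
  fixes x :: "'a::{ring, finite}"
  assumes n: "CARD('a) = 9" and x: "x \<notin> ring_center"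
  shows "card (centralizer x) = 3" "(ring_center :: 'a set) = {0}"
proof -
  let ?c = "card (centralizer x)" and ?z = "card (ring_center :: 'a set)"
  note facts = noncentral_card_facts[OF x]
  have c: "?c \<in> {2, 3, 4, 5, 6, 7, 8}" using facts(3-5) n by auto
  have "?c dvd 9" using facts(2) n by simp
  with c show c3: "?c = 3" by auto
  have "?z \<in> {1, 2}" using facts(3,4) c3 by auto
  moreover have "?z dvd 3" using facts(1) c3 by simp
  ultimately have "?z = 1" by auto
  then show "(ring_center :: 'a set) = {0}"
    using add_subgroup_zero[OF add_subgroup_center] by (metis card_1_singletonE singletonD)
qed

lemma order_9_degree:
  fixes x :: "'a::{ring, finite}"
  assumes "CARD('a) = 9" and "x \<notin> ring_center"
  shows "graph_degree (Delta_graph 0) x = 6"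
  using degree_zero[OF assms(2)] order_9_cards[OF assms] assms(1) by simp

lemma double_eq_uminus:
  fixes x :: "'a::ab_group_add"
  assumes "x + x + x = 0"
  shows "x + x = - x"
  using assms by (simp add: eq_neg_iff_add_eq_0)

text \<open>The centre is trivial, so the centralizer of each nonzero \<open>x\<close> has order 3.
  Hence 3 annihilates \<open>x\<close>, the elements \<open>0, x, - x\<close> are distinct, and they
  fill the centralizer: commuting with \<open>x\<close> means lying in its span over the field of
  three elements.\<close>

lemma order_9_commuting:
  fixes x :: "'a::{ring, finite}"
  assumes n: "CARD('a) = 9" and nc: "\<exists>x y :: 'a. x * y \<noteq> y * x"
  shows "x + x + x = 0"
    and "x \<noteq> 0 \<Longrightarrow> x * y = y * x \<longleftrightarrow> y \<in> {0, x, - x}"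
proof -
  obtain u :: 'a where u: "u \<notin> ring_center" using nc by (auto simp: ring_center_def)
  have center: "x \<notin> ring_center" if "x \<noteq> 0"
    using order_9_cards(2)[OF n u] that by auto
  show 3: "x + x + x = 0"
  proof (cases "x = 0")
    case False
    then show ?thesis
      using nat_mult_card_eq_0[OF add_subgroup_centralizer _ centralizer_self, of x]
        order_9_cards(1)[OF n center]
      by (simp add: eval_nat_numeral add.assoc)
  qed simp
  assume x0: "x \<noteq> 0"
  have "x \<noteq> - x"
    using 3 x0 double_eq_uminus[OF 3] by auto
  then have "card {0, x, - x} = 3" using x0 by simp
  moreover have "{0, x, - x} \<subseteq> centralizer x" by (auto simp: centralizer_def)
  ultimately have "{0, x, - x} = centralizer x"
    using order_9_cards(1)[OF n center[OF x0]] by (intro card_subset_eq) auto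
  then show "x * y = y * x \<longleftrightarrow> y \<in> {0, x, - x}"
    by (auto simp: centralizer_def)
qed

section \<open>Scalars modulo 3 and isomorphism criteria\<close>

text \<open>Scalar action of the integers modulo 3, with 2 acting as -1; it is additive in the
  scalar once \<open>x + x + x = 0\<close>.\<close>

definition smult3 :: "3 \<Rightarrow> 'a::ab_group_add \<Rightarrow> 'a" where
  "smult3 s x = (if s = 0 then 0 else if s = 1 then x else - x)"

lemma three_cases: "(s :: 3) = 0 \<or> s = 1 \<or> s = 2"
proof -
  have "{0, 1, 2 :: 3} = UNIV"
    by (rule card_subset_eq) auto
  then show ?thesis by (metis UNIV_I insertE singletonD)
qed


lemma smult3_add_left:
  assumes "x + x + x = 0"
  shows "smult3 (s + t) x = smult3 s x + smult3 t x"
proof -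
  have "x + x = - x" "- x - x = x"
    using double_eq_uminus[OF assms] by (simp, metis add_diff_cancel_right' diff_minus_eq_add
        minus_diff_eq uminus_add_conv_diff)
  then show ?thesis
    using three_cases[of s] three_cases[of t] by (elim disjE) (simp_all add: smult3_def)
qed

lemma smult3_mult: "smult3 s x * smult3 t y = smult3 (s * t) (x * y :: 'a::ring)"
  using three_cases[of s] three_cases[of t] by (auto simp: smult3_def)

text \<open>Linear independence modulo 3: \<open>{0, x, - x}\<close> is the span of
  \<open>x\<close>.\<close>

lemma smult3_independent:
  assumes "smult3 s x + smult3 t y = 0" "x \<noteq> 0" "y \<notin> {0, x, - x}"
  shows "s = 0" "t = 0"
proof -
  have "x + y \<noteq> 0" "x - y \<noteq> 0" "- x + y \<noteq> 0" "- x - y \<noteq> 0" "y \<noteq> 0"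
    using assms(3) by (auto simp: add_eq_0_iff diff_eq_eq)
  then show "s = 0" "t = 0"
    using assms(1,2) by (auto simp: smult3_def split: if_splits)
qed

lemma ring_isomorphic_sym:
  assumes "ring_isomorphic TYPE('a::ring) TYPE('b::ring)"
  shows "ring_isomorphic TYPE('b) TYPE('a)"
proof -
  obtain f :: "'a \<Rightarrow> 'b" where f: "bij f" "\<And>x y. f (x + y) = f x + f y"
      "\<And>x y. f (x * y) = f x * f y"
    using assms by (auto simp: ring_isomorphic_def)
  note inv_simps = f(2,3) surj_f_inv_f[OF bij_is_surj[OF f(1)]]
  have "inv f (x + y) = inv f x + inv f y" for x y
    by (rule inv_f_eq[OF bij_is_inj[OF f(1)]]) (simp add: inv_simps)
  moreover have "inv f (x * y) = inv f x * inv f y" for x y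
    by (rule inv_f_eq[OF bij_is_inj[OF f(1)]]) (simp add: inv_simps)
  ultimately have "\<forall>x y. inv f (x + y) = inv f x + inv f y"
      "\<forall>x y. inv f (x * y) = inv f x * inv f y" by simp_all
  then show ?thesis
    unfolding ring_isomorphic_def using bij_imp_bij_inv[OF f(1)] by blast
qed

lemma ring_isomorphic_card:
  assumes "ring_isomorphic TYPE('a::ring) TYPE('b::ring)"
  shows "CARD('a) = CARD('b)"
  using assms by (auto simp: ring_isomorphic_def intro: bij_betw_same_card)

lemma bij_of_additive_inj:
  fixes f :: "'a::ab_group_add \<Rightarrow> 'b::{ab_group_add, finite}"
  assumes add: "\<And>u v. f (u + v) = f u + f v" and ker: "\<And>u. f u = 0 \<Longrightarrow> u = 0"
    and card: "CARD('a) = CARD('b)"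
  shows "bij f"
proof -
  have "inj f"
  proof (rule injI)
    fix u v assume "f u = f v"
    then have "f (u - v) = 0"
      using add[of "u - v" v] by simp
    then show "u = v" using ker by fastforce
  qed
  moreover have "range f = UNIV"
    using card_image[OF \<open>inj f\<close>] card by (intro card_subset_eq) auto
  ultimately show ?thesis by (simp add: bij_def)
qed

text \<open>The map sends coordinates in the model to combinations of \<open>x\<close> and
  \<open>y\<close>. It starts from \<open>3 E_ring\<close>, where coordinates are given, and is
  reversed by symmetry at the end.\<close>

lemma isomorphic_E9:
  fixes x y :: "'a::{ring, finite}"
  assumes n: "CARD('a) = 9" and 3: "\<And>u :: 'a. u + u + u = 0"
    and ind: "x \<noteq> 0" "y \<notin> {0, x, - x}"
    and rel: "x * x = x" "y * y = y" "x * y = x" "y * x = y"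
  shows "ring_isomorphic TYPE('a) TYPE(3 E_ring)"
proof -
  let ?f = "\<lambda>u :: 3 E_ring. smult3 (E_coeff_a u) x + smult3 (E_coeff_b u) y"
  have add: "?f (u + v) = ?f u + ?f v" for u v
    by (simp add: plus_E_ring_def smult3_add_left[OF 3] algebra_simps)
  have mult: "?f (u * v) = ?f u * ?f v" for u v
    by (simp add: times_E_ring_def smult3_add_left[OF 3] distrib_left distrib_right
        smult3_mult rel algebra_simps)
  have "bij ?f"
  proof (rule bij_of_additive_inj[OF add])
    fix u :: "3 E_ring" assume "?f u = 0"
    then show "u = 0"
      using smult3_independent[OF _ ind] by (cases u) (auto simp: zero_E_ring_def)
  qed (simp add: n card_E9)
  then have "ring_isomorphic TYPE(3 E_ring) TYPE('a)"
    unfolding ring_isomorphic_def using add mult by blast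
  then show ?thesis by (rule ring_isomorphic_sym)
qed

lemma isomorphic_F9:
  fixes x y :: "'a::{ring, finite}"
  assumes n: "CARD('a) = 9" and 3: "\<And>u :: 'a. u + u + u = 0"
    and ind: "x \<noteq> 0" "y \<notin> {0, x, - x}"
    and rel: "x * x = x" "y * y = y" "x * y = y" "y * x = x"
  shows "ring_isomorphic TYPE('a) TYPE(3 F_ring)"
proof -
  let ?f = "\<lambda>u :: 3 F_ring. smult3 (F_coeff_x u) x + smult3 (F_coeff_y u) y"
  have add: "?f (u + v) = ?f u + ?f v" for u v
    by (simp add: plus_F_ring_def smult3_add_left[OF 3] algebra_simps)
  have mult: "?f (u * v) = ?f u * ?f v" for u v
    by (simp add: times_F_ring_def smult3_add_left[OF 3] distrib_left distrib_right
        smult3_mult rel algebra_simps)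
  have "bij ?f"
  proof (rule bij_of_additive_inj[OF add])
    fix u :: "3 F_ring" assume "?f u = 0"
    then show "u = 0"
      using smult3_independent[OF _ ind] by (cases u) (auto simp: zero_F_ring_def)
  qed (simp add: n card_F9)
  then have "ring_isomorphic TYPE(3 F_ring) TYPE('a)"
    unfolding ring_isomorphic_def using add mult by blast
  then show ?thesis by (rule ring_isomorphic_sym)
qed

section \<open>Classification in order 9\<close>

lemma order_9_isomorphic:
  assumes n: "CARD('a::{ring, finite}) = 9" and nc: "\<exists>x y :: 'a. x * y \<noteq> y * x"
  shows "ring_isomorphic TYPE('a) TYPE(3 E_ring) \<or> ring_isomorphic TYPE('a) TYPE(3 F_ring)"
proof -
  have 3: "u + u + u = 0" for u :: 'a
    using order_9_commuting(1)[OF n nc] .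
  note double = double_eq_uminus[OF 3]
  have neg_double: "- u - u = u" for u :: 'a
    using double[of "- u"] by simp
  have comm: "v \<in> {0, u, - u}" if "u * v = v * u" "u \<noteq> 0" for u v :: 'a
    using order_9_commuting(2)[OF n nc] that by blast
  have sq: "u * u \<in> {0, u, - u}" for u :: 'a
    using comm[of u "u * u"] by (cases "u = 0") (auto simp: mult.assoc)
  \<comment> \<open>If all squares vanished, expanding the square of \<open>x + y\<close> would give
    \<open>y * x = - (x * y)\<close>. Then \<open>x * y\<close> commutes with both \<open>x\<close>
    and \<open>y\<close>, so it is in both spans; either it is 0 or \<open>y\<close> is
    \<open>x\<close> or \<open>- x\<close>, and \<open>x\<close>, \<open>y\<close> commute.\<close>
  have "\<exists>u :: 'a. u * u \<noteq> 0"
  proof (rule ccontr)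
    assume "\<nexists>u :: 'a. u * u \<noteq> 0"
    then have sq0: "u * u = 0" for u :: 'a by blast
    obtain x y :: 'a where xy: "x * y \<noteq> y * x" using nc by blast
    have "y * x + x * y = (x + y) * (x + y) - x * x - y * y"
      by (simp add: algebra_simps)
    then have anti: "y * x = - (x * y)"
      by (simp add: sq0 eq_neg_iff_add_eq_0)
    have "x * (x * y) = 0" by (simp add: sq0 flip: mult.assoc)
    moreover have "(x * y) * x = 0" by (simp add: mult.assoc anti calculation)
    ultimately have "x * y \<in> {0, x, - x}" using comm[of x "x * y"] xy by fastforce
    moreover have y1: "(x * y) * y = 0" by (simp add: mult.assoc sq0)
    moreover have "y * (x * y) = 0" using y1 by (simp add: anti flip: mult.assoc)
    then have "x * y \<in> {0, y, - y}" using comm[of y "x * y"] xy y1 by fastforce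
    ultimately show False using xy anti by (auto simp: minus_equation_iff)
  qed
  then obtain u :: 'a where "u * u \<noteq> 0" by blast
  \<comment> \<open>If the square of \<open>u\<close> is \<open>- u\<close>, then \<open>- u\<close>
    is idempotent.\<close>
  define x where "x = (if u * u = u then u else - u)"
  have x: "x * x = x" "x \<noteq> 0"
    using sq[of u] \<open>u * u \<noteq> 0\<close> by (auto simp: x_def)
  have "card {0, x, - x} \<le> 3" by (simp add: card_insert_if)
  then have "{0, x, - x} \<noteq> UNIV" using n by auto
  then obtain z where z: "z \<notin> {0, x, - x}" by blast
  \<comment> \<open>Otherwise each of the three squares is 0 or the negative of its base, while they
    sum to \<open>- x\<close>. Since \<open>z\<close> is outside the span of \<open>x\<close>, its
    coefficient must vanish modulo 3, so none or all three squares are nonzero; in both cases the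
    sum is 0.\<close>
  have "z * z = z \<or> (z + x) * (z + x) = z + x \<or> (z - x) * (z - x) = z - x"
  proof (rule ccontr)
    assume "\<not> ?thesis"
    then have "z * z \<in> {0, - z}" "(z + x) * (z + x) \<in> {0, - (z + x)}"
        "(z - x) * (z - x) \<in> {0, - (z - x)}"
      using sq[of z] sq[of "z + x"] sq[of "z - x"] by auto
    moreover have "z * z + (z + x) * (z + x) + (z - x) * (z - x) =
        (z * z + z * z + z * z) + (x * x + x * x)"
      by (simp add: algebra_simps)
    then have "z * z + (z + x) * (z + x) + (z - x) * (z - x) = - x"
      by (simp add: 3 x double)
    moreover have False
      if "P \<in> {0, - z}" "Q \<in> {0, - (z + x)}" "S \<in> {0, - (z - x)}" "P + Q + S = - x" for P Q S
    proof -
      have "x + z \<noteq> - x"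
        using z double[of x] by (metis add_left_cancel insertCI)
      moreover have "x \<noteq> z + z"
        using z double[of z] by auto
      ultimately show False
        using that x(2) z double[of z] double[of x] by (auto simp: algebra_simps)
    qed
    ultimately show False by blast
  qed
  then obtain y where y: "y * y = y" "y \<notin> {0, x, - x}"
  proof (elim disjE)
    assume "(z + x) * (z + x) = z + x"
    moreover have "z + x \<notin> {0, x, - x}"
      using z neg_double[of x] by (metis add_diff_cancel_right' cancel_comm_monoid_add_class.diff_cancel
          diff_0 insertCI insertE singletonD)
    ultimately show ?thesis using that by blast
  next
    assume "(z - x) * (z - x) = z - x"
    moreover have "z - x \<notin> {0, x, - x}"
      using z double[of x] by (auto simp: diff_eq_eq)
    ultimately show ?thesis using that by blast
  qed (use that z in blast)
  have noncomm: "x * y \<noteq> y * x" using comm[of x y] x y by blast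
  \<comment> \<open>The squares of \<open>x + y\<close> and \<open>x - y\<close> add up to
    \<open>- (x + y)\<close>. If the latter square were \<open>x - y\<close> or
    \<open>- (x - y)\<close>, the former would be \<open>x\<close> or \<open>y\<close>, outside the
    span of \<open>x + y\<close>. So the square of \<open>x - y\<close> is 0, which is the
    claim.\<close>
  have sum: "x * y + y * x = x + y"
  proof -
    have exp: "(x + y) * (x + y) = x + y + (x * y + y * x)"
        "(x - y) * (x - y) = x + y - (x * y + y * x)"
      by (simp_all add: algebra_simps x y)
    have "(x + y) * (x + y) + (x - y) * (x - y) = (x + y) + (x + y)"
      unfolding exp by (simp add: algebra_simps)
    then have tot: "(x + y) * (x + y) = - (x + y) - (x - y) * (x - y)"
      by (simp only: double eq_diff_eq)
    have "(x - y) * (x - y) \<noteq> x - y"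
    proof
      assume "(x - y) * (x - y) = x - y"
      with tot have "(x + y) * (x + y) = - (x + y) - (x - y)" by (simp only:)
      then have "(x + y) * (x + y) = - (x + x)" by simp
      then have "(x + y) * (x + y) = x" by (simp only: double minus_minus)
      with sq[of "x + y"] have "x \<in> {0, x + y, - (x + y)}" by simp
      moreover have "x \<noteq> - (x + y)"
      proof
        assume "x = - (x + y)"
        then have "y = - x - x" by (simp add: eq_diff_eq eq_neg_iff_add_eq_0 ac_simps)
        then show False using neg_double[of x] y(2) by simp
      qed
      ultimately show False using x y(2) by simp
    qed
    moreover have "(x - y) * (x - y) \<noteq> - (x - y)"
    proof
      assume "(x - y) * (x - y) = - (x - y)"
      with tot have "(x + y) * (x + y) = - (x + y) - (- (x - y))" by (simp only:)
      then have "(x + y) * (x + y) = - (y + y)" by simp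
      then have "(x + y) * (x + y) = y" by (simp only: double minus_minus)
      with sq[of "x + y"] have "y \<in> {0, x + y, - (x + y)}" by simp
      moreover have "y \<noteq> - (x + y)"
      proof
        assume "y = - (x + y)"
        then have "x = - y - y" by (simp add: eq_diff_eq eq_neg_iff_add_eq_0 ac_simps)
        then show False using neg_double[of y] y(2) by simp
      qed
      ultimately show False using x y(2) by simp
    qed
    ultimately have "(x - y) * (x - y) = 0" using sq[of "x - y"] by blast
    then show ?thesis using exp(2) by simp
  qed
  \<comment> \<open>Multiplying \<open>sum\<close> by \<open>x\<close> on the left cancels
    \<open>x * y\<close>; \<open>yxy\<close> follows likewise with \<open>y\<close>.\<close>
  have xyx: "x * y * x = x"
  proof -
    have "x * (x * y + y * x) = x * (x + y)" by (simp only: sum)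
    then show ?thesis by (simp add: distrib_left x mult.assoc flip: mult.assoc[of x x])
  qed
  have yxy: "y * x * y = y"
  proof -
    have "y * (x * y + y * x) = y * (x + y)" by (simp only: sum)
    then show ?thesis by (simp add: distrib_left y mult.assoc flip: mult.assoc[of y y])
  qed
  \<comment> \<open>Both products vanish, so the two factors commute and are linearly dependent.
    Equality of the factors would give \<open>x = y\<close>, opposite signs would give
    \<open>x * y = y * x\<close>; hence one factor is 0.\<close>
  have "(x * y - x) * (x * y - y) = (x * y - y) * (x * y - x)"
  proof -
    have "(x * y - x) * (x * y - y) = (x * y * x) * y - x * (y * y) - (x * x) * y + x * y"
      by (simp add: algebra_simps)
    then have "(x * y - x) * (x * y - y) = 0" by (simp only: x y xyx) simp
    moreover have "(x * y - y) * (x * y - x) = (x * y * x) * y - x * y * x - y * x * y + y * x"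
      by (simp add: algebra_simps)
    then have "(x * y - y) * (x * y - x) = 0"
      unfolding xyx yxy using sum by (simp add: algebra_simps)
    ultimately show ?thesis by simp
  qed
  then have "x * y - x = 0 \<or> x * y - y \<in> {0, x * y - x, - (x * y - x)}"
    using comm by blast
  moreover have "x * y - y \<noteq> x * y - x" using y(2) by simp
  moreover have "x * y - y \<noteq> - (x * y - x)"
  proof
    assume "x * y - y = - (x * y - x)"
    then have "x * y + x * y = x * y + y * x" unfolding sum by (simp add: algebra_simps)
    then show False using noncomm by simp
  qed
  ultimately consider "x * y = x" | "x * y = y" by fastforce
  then show ?thesis
  proof cases
    case 1
    then have "y * x = y" using sum by simp
    then show ?thesis using isomorphic_E9[OF n 3 x(2) y(2) x(1) y(1) 1] by simp
  next
    case 2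
    then have "y * x = x" using sum by (simp add: add.commute)
    then show ?thesis using isomorphic_F9[OF n 3 x(2) y(2) x(1) y(1) 2] by simp
  qed
qed

theorem corollary4p19:
  fixes r :: "'a::{ring, finite}"
  assumes noncommutative: "\<exists>x y :: 'a. x * y \<noteq> y * x"
    and card: "CARD('a) \<notin> {8, 12, 16, 24, 28}"
  shows "(k_regular 6 (Delta_graph r) \<longleftrightarrow>
           r = 0 \<and> (ring_isomorphic TYPE('a) TYPE(3 E_ring) \<or> ring_isomorphic TYPE('a) TYPE(3 F_ring)))
       \<and> (k_regular 6 (noncommuting_graph :: 'a graph) \<longleftrightarrow>
           ring_isomorphic TYPE('a) TYPE(3 E_ring) \<or> ring_isomorphic TYPE('a) TYPE(3 F_ring))"
proof -
  obtain x :: 'a where x: "x \<notin> ring_center"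
    using noncommutative by (auto simp: ring_center_def)
  have regular: "k_regular 6 (Delta_graph s) \<longleftrightarrow>
      (\<forall>v. v \<notin> ring_center \<longrightarrow> graph_degree (Delta_graph s) v = 6)" for s :: 'a
    by (auto simp: k_regular_def Delta_graph_def)
  let ?iso = "ring_isomorphic TYPE('a) TYPE(3 E_ring) \<or> ring_isomorphic TYPE('a) TYPE(3 F_ring)"
  \<comment> \<open>The classification reduces the isomorphism condition to a cardinality, so only
    orders remain to be compared.\<close>
  have iso: "?iso \<longleftrightarrow> CARD('a) = 9"
  proof
    assume ?iso
    then show "CARD('a) = 9"
      using ring_isomorphic_card[where 'a = 'a and 'b = "3 E_ring"]
        ring_isomorphic_card[where 'a = 'a and 'b = "3 F_ring"] card_E9 card_F9 by auto
  qed (rule order_9_isomorphic[OF _ noncommutative])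
  have zero: "k_regular 6 (Delta_graph (0 :: 'a)) \<longleftrightarrow> CARD('a) = 9"
    using degree_six_zero[OF x] card order_9_degree x by (auto simp: regular)
  \<comment> \<open>One noncentral vertex of degree 6 already forces an excluded order when
    \<open>s\<close> is nonzero.\<close>
  have nonzero: "s = 0" if "k_regular 6 (Delta_graph s)" for s :: 'a
    using degree_six_nonzero[OF x] that x card by (metis regular)
  show ?thesis
    unfolding noncommuting_graph_eq_Delta_graph iso using zero nonzero by blast
qed

end
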